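(* Assume $\nu$ is a probability measure. If $\lambda\ne0$ is an $m$-eigenvalue of $\Delta_1^m$, then $$h_m(X)\le\lambda.$$
   Context: Metric random walk space: $(X,d)$ is a Polish metric space with its Borel $\sigma$-algebra and $m=(m_x)_{x\in X}$ is a family of Borel probability measures on $X$ such that $x\mapsto m_x(A)$ is Borel for every Borel set $A$, and each $m_x$ has finite first moment ($\int_X d(z,y)\,dm_x(y)<\infty$ for some, hence every, $z\in X$). $\nu$ is a Radon probability measure on $X$ that is invariant, $\nu(A)=\int_X m_x(A)\,d\nu(x)$, and reversible for $m$: for every Borel $C\subset X\times X$, $\int_X\int_X\chi_C(x,y)\,dm_x(y)d\nu(x)=\int_X\int_X\chi_C(x,y)\,dm_y(x)d\nu(y)$. Put $L_m(A,B)=\int_A\int_B dm_x(y)d\nu(x)$; the space is assumed $m$-connected: $L_m(A,B)>0$ for any $\nu$-measurable sets $A,B$ of positive $\nu$-measure with $A\cup B=X$. $P_m(E)=L_m(E,X\setminus E)$. The $m$-Cheeger constant of $X$ is $h_m(X)=\inf\left\{\frac{P_m(D)}{\nu(D)}: D\subset X \ \nu\text{-measurable},\ 0<\nu(D)\le\frac12\right\}$. For $\nu$-measurable $u$, $TV_m(u)=\frac12\int_X\int_X|u(y)-u(x)|\,dm_x(y)d\nu(x)$; $\mathcal F_m:L^2(X,\nu)\to[0,+\infty]$, $\mathcal F_m(u)=TV_m(u)$. $w\in\partial\mathcal F_m(u)$ iff $\mathcal F_m(u)<\infty$ and $\mathcal F_m(z)\ge\mathcal F_m(u)+\int_X w(z-u)\,d\nu$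 for all $z\in L^2(X,\nu)$; $v\in\Delta_1^m u$ iff $-v\in\partial\mathcal F_m(u)$. Multivalued sign: $\mathrm{sign}(r)=1$ if $r>0$, $[-1,1]$ if $r=0$, $-1$ if $r<0$. A pair $(\lambda,u)\in\mathbb R\times L^2(X,\nu)$ is an $m$-eigenpair of $\Delta_1^m$ if $\|u\|_{L^1(X,\nu)}=1$ and there is a function $\xi$ with $\xi(x)\in\mathrm{sign}(u(x))$ such that $\lambda\xi\in\partial\mathcal F_m(u)=-\Delta_1^m u$; then $\lambda$ is called an $m$-eigenvalue. *)

theory Defs
  imports "HOL-Probability.Probability_Measure"
begin

text \<open>
  The underlying space is the whole of a type \<open>'a\<close> of class \<open>polish_space\<close> (a complete
  metric on a second countable space); \<open>m x\<close> is the jump probability from \<open>x\<close>.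
\<close>

locale metric_random_walk =
  fixes m :: "'a::polish_space \<Rightarrow> 'a measure"
  assumes sets_m: "sets (m x) = sets borel"
    and prob_m: "prob_space (m x)"
    and kernel_m: "A \<in> sets borel \<Longrightarrow> (\<lambda>x. emeasure (m x) A) \<in> borel_measurable borel"
    and first_moment_m: "\<exists>z. (\<integral>\<^sup>+y. ennreal (dist z y) \<partial>m x) < \<infinity>"

definition radon_measure :: "'a::polish_space measure \<Rightarrow> bool" where
  "radon_measure \<nu> \<longleftrightarrow>
     sets \<nu> = sets borel \<and>
     (\<forall>K. compact K \<longrightarrow> emeasure \<nu> K < \<infinity>) \<and>
     (\<forall>A\<in>sets borel. emeasure \<nu> A = (SUP K\<in>{K. compact K \<and> K \<subseteq> A}. emeasure \<nu> K))"

definition invariant_measure :: "('a::polish_space \<Rightarrow> 'a measure) \<Rightarrow> 'a measure \<Rightarrow> bool" where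
  "invariant_measure m \<nu> \<longleftrightarrow>
     (\<forall>A\<in>sets borel. emeasure \<nu> A = (\<integral>\<^sup>+x. emeasure (m x) A \<partial>\<nu>))"

definition reversible_measure :: "('a::polish_space \<Rightarrow> 'a measure) \<Rightarrow> 'a measure \<Rightarrow> bool" where
  "reversible_measure m \<nu> \<longleftrightarrow>
     (\<forall>C\<in>sets (borel :: ('a \<times> 'a) measure).
        (\<integral>\<^sup>+x. (\<integral>\<^sup>+y. indicator C (x, y) \<partial>m x) \<partial>\<nu>) =
        (\<integral>\<^sup>+y. (\<integral>\<^sup>+x. indicator C (x, y) \<partial>m y) \<partial>\<nu>))"

text \<open>
  \<open>\<nu>\<close>-measurable sets and functions are those measurable for \<open>completion \<nu>\<close>.
  If \<open>\<nu>\<close> is invariant, a \<open>\<nu>\<close>-null set is \<open>m x\<close>-null for \<open>\<nu>\<close>-almost every \<open>x\<close>.  Hence a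
  \<open>\<nu>\<close>-measurable set or function is measurable for \<open>completion (m x)\<close> for almost every
  \<open>x\<close>, and the inner measures and integrals below are meaningful outside a null set of \<open>x\<close>.
\<close>

definition interaction ::
    "('a::polish_space \<Rightarrow> 'a measure) \<Rightarrow> 'a measure \<Rightarrow> 'a set \<Rightarrow> 'a set \<Rightarrow> ennreal" where
  "interaction m \<nu> A B = (\<integral>\<^sup>+x\<in>A. emeasure (completion (m x)) B \<partial>completion \<nu>)"

definition m_connected :: "('a::polish_space \<Rightarrow> 'a measure) \<Rightarrow> 'a measure \<Rightarrow> bool" where
  "m_connected m \<nu> \<longleftrightarrow>
     (\<forall>A\<in>sets (completion \<nu>). \<forall>B\<in>sets (completion \<nu>).
        0 < emeasure (completion \<nu>) A \<longrightarrow> 0 < emeasure (completion \<nu>) B \<longrightarrow> A \<union> B = UNIV \<longrightarrow>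
        0 < interaction m \<nu> A B)"

definition perimeter ::
    "('a::polish_space \<Rightarrow> 'a measure) \<Rightarrow> 'a measure \<Rightarrow> 'a set \<Rightarrow> ennreal" where
  "perimeter m \<nu> E = interaction m \<nu> E (- E)"

text \<open>The infimum over the empty family is \<open>\<infinity>\<close>.\<close>

definition cheeger_constant ::
    "('a::polish_space \<Rightarrow> 'a measure) \<Rightarrow> 'a measure \<Rightarrow> ennreal" where
  "cheeger_constant m \<nu> =
     (INF D\<in>{D \<in> sets (completion \<nu>).
              0 < emeasure (completion \<nu>) D \<and> emeasure (completion \<nu>) D \<le> 1 / 2}.
        perimeter m \<nu> D / emeasure (completion \<nu>) D)"

definition total_variation ::
    "('a::polish_space \<Rightarrow> 'a measure) \<Rightarrow> 'a measure \<Rightarrow> ('a \<Rightarrow> real) \<Rightarrow> ennreal" where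
  "total_variation m \<nu> u =
     1 / 2 * (\<integral>\<^sup>+x. (\<integral>\<^sup>+y. ennreal \<bar>u y - u x\<bar> \<partial>completion (m x)) \<partial>completion \<nu>)"

text \<open>
  Elements of \<open>L\<^sup>2\<close> are represented by functions; for invariant \<open>\<nu>\<close> the notions below are
  unchanged when the functions are modified on a \<open>\<nu>\<close>-null set.
\<close>

definition L2_functions :: "'a measure \<Rightarrow> ('a \<Rightarrow> real) set" where
  "L2_functions \<nu> =
     {u \<in> borel_measurable (completion \<nu>). integrable (completion \<nu>) (\<lambda>x. (u x)\<^sup>2)}"

text \<open>The subdifferential of \<open>total_variation m \<nu>\<close> as a functional on \<open>L\<^sup>2\<close>.\<close>

definition TV_subdifferential ::
    "('a::polish_space \<Rightarrow> 'a measure) \<Rightarrow> 'a measure \<Rightarrow> ('a \<Rightarrow> real) \<Rightarrow> ('a \<Rightarrow> real) set" where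
  "TV_subdifferential m \<nu> u =
     {w \<in> L2_functions \<nu>.
        total_variation m \<nu> u < \<infinity> \<and>
        (\<forall>z\<in>L2_functions \<nu>.
           enn2ereal (total_variation m \<nu> u) + ereal (LINT x|completion \<nu>. w x * (z x - u x))
             \<le> enn2ereal (total_variation m \<nu> z))}"

definition one_laplacian ::
    "('a::polish_space \<Rightarrow> 'a measure) \<Rightarrow> 'a measure \<Rightarrow> ('a \<Rightarrow> real) \<Rightarrow> ('a \<Rightarrow> real) set" where
  "one_laplacian m \<nu> u = {v. (\<lambda>x. - v x) \<in> TV_subdifferential m \<nu> u}"

definition multi_sign :: "real \<Rightarrow> real set" where
  "multi_sign r = (if 0 < r then {1} else if r = 0 then {-1..1} else {-1})"

definition m_eigenpair ::
    "('a::polish_space \<Rightarrow> 'a measure) \<Rightarrow> 'a measure \<Rightarrow> real \<Rightarrow> ('a \<Rightarrow> real) \<Rightarrow> bool" where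
  "m_eigenpair m \<nu> lam u \<longleftrightarrow>
     u \<in> L2_functions \<nu> \<and>
     (LINT x|completion \<nu>. \<bar>u x\<bar>) = 1 \<and>
     (\<exists>\<xi>. (AE x in completion \<nu>. \<xi> x \<in> multi_sign (u x)) \<and>
          (\<lambda>x. - (lam * \<xi> x)) \<in> one_laplacian m \<nu> u)"

definition m_eigenvalue :: "('a::polish_space \<Rightarrow> 'a measure) \<Rightarrow> 'a measure \<Rightarrow> real \<Rightarrow> bool" where
  "m_eigenvalue m \<nu> lam \<longleftrightarrow> (\<exists>u. m_eigenpair m \<nu> lam u)"

end

theory Submission
  imports Defs "HOL-Probability.Giry_Monad"
begin

text \<open>
  Let \<open>u\<close> be an eigenfunction with subgradient \<open>\<lambda>\<xi>\<close> and let \<open>h\<close> be the Cheeger constant.  The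
  subgradient makes \<open>0\<close> a median of \<open>u\<close>, so that the sets \<open>{u > t}\<close> with \<open>t \<ge> 0\<close> and \<open>{u < t}\<close> with
  \<open>t \<le> 0\<close> have measure at most \<open>1/2\<close>.  Integrating the isoperimetric inequality of these sets
  over the levels \<open>t\<close> gives \<open>h = h \<parallel>u\<parallel>\<^sub>1 \<le> TV u\<close>, and \<open>TV u \<le> \<lambda>\<close>.

  In detail, \<open>TV\<close> does not change when constants are added.  Testing the subgradient
  inequality with \<open>u + c\<close> therefore gives \<open>c \<lambda> \<integral> \<xi> d\<nu> \<le> 0\<close> for all real \<open>c\<close>, so \<open>\<integral> \<xi> d\<nu> = 0\<close> since
  \<open>\<lambda> \<noteq> 0\<close>.  As \<open>\<xi> = 1\<close> where \<open>u > 0\<close> and \<open>\<xi> \<ge> -1\<close> elsewhere, \<open>\<nu> {u > 0} \<le> 1/2\<close>, and likewise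
  \<open>\<nu> {u < 0} \<le> 1/2\<close> (\<open>median_of_mean_zero_sign\<close>).
  Testing with \<open>0\<close> gives \<open>TV u \<le> \<lambda> \<integral> \<xi> u d\<nu> = \<lambda> \<parallel>u\<parallel>\<^sub>1 = \<lambda>\<close>.

  It remains to see that \<open>h \<parallel>u\<parallel>\<^sub>1 \<le> TV u\<close> whenever \<open>0\<close> is a median of \<open>u\<close>
  (\<open>cheeger_le_total_variation\<close>).  Let \<open>\<mu>(dx, dy) = m\<^sub>x(dy) \<nu>(dx)\<close> be the law of one step of the walk
  started in \<open>\<nu>\<close>.  A set \<open>D\<close> has perimeter \<open>\<mu> (D \<times> - D)\<close>, and
  \<open>TV u = 1/2 \<integral> |u y - u x| d\<mu>\<close>.  For nonnegative \<open>g\<close>, writing \<open>g\<close> and \<open>(g x - g y)\<^sup>+\<close> as integrals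
  over levels \<open>t \<ge> 0\<close> of indicator functions and applying \<open>h \<nu> {g > t} \<le> \<mu> ({g > t} \<times> {g \<le> t})\<close> gives
  \<open>h \<integral> g d\<nu> \<le> \<integral> (g x - g y)\<^sup>+ d\<mu>\<close> (\<open>cheeger_coarea\<close>).  With \<open>g = u\<^sup>+\<close> and \<open>g = u\<^sup>-\<close> the two right-hand
  integrands add up to a function \<open>\<phi>\<close> with \<open>\<phi>(x, y) + \<phi>(y, x) = |u y - u x|\<close>, and reversibility,
  which is the symmetry of \<open>\<mu>\<close>, yields \<open>\<integral> \<phi> d\<mu> = TV u\<close>.
\<close>

section \<open>The law of one step\<close>

lemma measurable_swap [measurable]: "prod.swap \<in> M \<Otimes>\<^sub>M N \<rightarrow>\<^sub>M N \<Otimes>\<^sub>M M"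
  unfolding prod.swap_def by measurable

locale reversible_random_walk = metric_random_walk m + prob_space \<nu>
  for m :: "'a::polish_space \<Rightarrow> 'a measure" and \<nu> :: "'a measure" +
  assumes sets_stationary: "sets \<nu> = sets borel"
    and invariant: "invariant_measure m \<nu>"
    and reversible: "reversible_measure m \<nu>"
begin

definition step_law :: "('a \<times> 'a) measure" where
  "step_law = \<nu> \<bind> (\<lambda>x. distr (m x) (borel \<Otimes>\<^sub>M borel) (Pair x))"

lemma space_m [simp]: "space (m x) = UNIV"
  using sets_eq_imp_space_eq[OF sets_m[of x]] by simp

lemma space_stationary [simp]: "space \<nu> = UNIV"
  using sets_eq_imp_space_eq[OF sets_stationary] by simp

declare sets_m [measurable_cong] sets_stationary [measurable_cong]

lemma kernel [measurable]: "m \<in> borel \<rightarrow>\<^sub>M subprob_algebra borel"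
  by (intro measurable_subprob_algebra prob_space_imp_subprob_space prob_m sets_m kernel_m)

lemma step_kernel [measurable]:
  "(\<lambda>x. distr (m x) (borel \<Otimes>\<^sub>M borel) (Pair x)) \<in> \<nu> \<rightarrow>\<^sub>M subprob_algebra (borel \<Otimes>\<^sub>M borel)"
proof -
  have "(\<lambda>x. distr (m x) (borel \<Otimes>\<^sub>M borel) (Pair x)) \<in> borel \<rightarrow>\<^sub>M subprob_algebra (borel \<Otimes>\<^sub>M borel)"
    by (rule measurable_distr2[OF _ kernel]) simp
  then show ?thesis
    by (simp cong: measurable_cong_sets add: sets_stationary)
qed

lemma sets_step_law [simp, measurable_cong]: "sets step_law = sets (borel \<Otimes>\<^sub>M borel)"
  unfolding step_law_def by (rule sets_bind) auto

lemma nn_integral_step_law: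
  assumes f [measurable]: "f \<in> borel_measurable (borel \<Otimes>\<^sub>M borel)"
  shows "(\<integral>\<^sup>+p. f p \<partial>step_law) = (\<integral>\<^sup>+x. \<integral>\<^sup>+y. f (x, y) \<partial>m x \<partial>\<nu>)"
proof -
  have "(\<integral>\<^sup>+p. f p \<partial>step_law) = (\<integral>\<^sup>+x. \<integral>\<^sup>+p. f p \<partial>distr (m x) (borel \<Otimes>\<^sub>M borel) (Pair x) \<partial>\<nu>)"
    unfolding step_law_def by (rule nn_integral_bind[OF f step_kernel])
  also have "\<dots> = (\<integral>\<^sup>+x. \<integral>\<^sup>+y. f (x, y) \<partial>m x \<partial>\<nu>)"
    by (intro nn_integral_cong nn_integral_distr) auto
  finally show ?thesis .
qed

lemma sigma_finite_step_law: "sigma_finite_measure step_law"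
proof -
  have "subprob_space step_law"
    unfolding step_law_def
    by (rule subprob_space_bind[OF prob_space_imp_subprob_space step_kernel]) unfold_locales
  then show ?thesis
    using finite_measure.axioms(1) subprob_space.axioms(1) by blast
qed

lemma step_law_swap: "distr step_law (borel \<Otimes>\<^sub>M borel) prod.swap = step_law"
proof (rule measure_eqI)
  fix C :: "('a \<times> 'a) set"
  assume "C \<in> sets (distr step_law (borel \<Otimes>\<^sub>M borel) prod.swap)"
  then have C [measurable]: "C \<in> sets (borel \<Otimes>\<^sub>M borel)" by simp
  have "emeasure (distr step_law (borel \<Otimes>\<^sub>M borel) prod.swap) C
      = (\<integral>\<^sup>+p. indicator C p \<partial>distr step_law (borel \<Otimes>\<^sub>M borel) prod.swap)"
    by simp
  also have "\<dots> = (\<integral>\<^sup>+p. indicator C (prod.swap p) \<partial>step_law)"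
    by (rule nn_integral_distr) auto
  also have "\<dots> = (\<integral>\<^sup>+y. (\<integral>\<^sup>+x. indicator C (x, y) \<partial>m y) \<partial>\<nu>)"
    by (subst nn_integral_step_law) auto
  also have "\<dots> = (\<integral>\<^sup>+x. (\<integral>\<^sup>+y. indicator C (x, y) \<partial>m x) \<partial>\<nu>)"
    by (rule reversible[unfolded reversible_measure_def borel_prod[symmetric], rule_format, OF C, symmetric])
  also have "\<dots> = emeasure step_law C"
    by (subst nn_integral_step_law[symmetric]) auto
  finally show "emeasure (distr step_law (borel \<Otimes>\<^sub>M borel) prod.swap) C = emeasure step_law C" .
qed simp

lemma nn_integral_step_law_swap:
  assumes f [measurable]: "f \<in> borel_measurable (borel \<Otimes>\<^sub>M borel)"
  shows "(\<integral>\<^sup>+p. f (prod.swap p) \<partial>step_law) = (\<integral>\<^sup>+p. f p \<partial>step_law)"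
  using nn_integral_distr[of prod.swap step_law "borel \<Otimes>\<^sub>M borel" f]
  by (simp add: step_law_swap)

text \<open>
  By invariance a \<open>\<nu>\<close>-null set is missed by almost every step, so \<open>u\<close> may be replaced by a Borel
  version inside both integrals.
\<close>

lemma total_variation_eq_step_law:
  assumes v [measurable]: "v \<in> borel_measurable borel" and uv: "AE x in \<nu>. u x = v x"
  shows "total_variation m \<nu> u = 1 / 2 * (\<integral>\<^sup>+(x, y). ennreal \<bar>v y - v x\<bar> \<partial>step_law)"
proof -
  obtain N where N: "N \<in> null_sets \<nu>" "{x. u x \<noteq> v x} \<subseteq> N"
    using uv by (auto simp: eventually_ae_filter)
  then have [measurable]: "N \<in> sets borel" and "(\<integral>\<^sup>+x. emeasure (m x) N \<partial>\<nu>) = 0"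
    using invariant by (auto simp: null_sets_def sets_stationary invariant_measure_def)
  then have null: "AE x in \<nu>. emeasure (m x) N = 0"
    by (subst (asm) nn_integral_0_iff_AE)
      (auto cong: measurable_cong_sets simp: sets_stationary intro!: kernel_m)
  have "(\<integral>\<^sup>+x. (\<integral>\<^sup>+y. ennreal \<bar>u y - u x\<bar> \<partial>m x) \<partial>\<nu>) = (\<integral>\<^sup>+x. (\<integral>\<^sup>+y. ennreal \<bar>v y - v x\<bar> \<partial>m x) \<partial>\<nu>)"
  proof (rule nn_integral_cong_AE, use uv null in eventually_elim)
    fix x assume x: "u x = v x" "emeasure (m x) N = 0"
    then have "AE y in m x. y \<notin> N"
      by (intro AE_not_in) (auto simp: null_sets_def sets_m)
    then have "AE y in m x. u y = v y"
      by (rule eventually_mono) (use N(2) in blast)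
    then show "(\<integral>\<^sup>+y. ennreal \<bar>u y - u x\<bar> \<partial>m x) = (\<integral>\<^sup>+y. ennreal \<bar>v y - v x\<bar> \<partial>m x)"
      unfolding x(1) by (intro nn_integral_cong_AE) (rule eventually_mono, auto)
  qed
  also have "\<dots> = (\<integral>\<^sup>+(x, y). ennreal \<bar>v y - v x\<bar> \<partial>step_law)"
    by (subst nn_integral_step_law) auto
  finally show ?thesis
    by (simp add: total_variation_def nn_integral_completion)
qed

section \<open>Isoperimetric inequality and coarea formula\<close>

text \<open>
  Stated as a product rather than a quotient, the inequality also holds for null sets, where
  \<open>0 \<cdot> \<infinity> = 0\<close>; a null level set is then no special case in the integration over levels.
\<close>

lemma cheeger_mult_le:
  assumes D [measurable]: "D \<in> sets borel" and half: "emeasure \<nu> D \<le> 1 / 2"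
  shows "cheeger_constant m \<nu> * emeasure \<nu> D \<le> emeasure step_law (D \<times> - D)"
proof (cases "emeasure \<nu> D = 0")
  case False
  have D': "D \<in> sets \<nu>" by (simp add: sets_stationary)
  have per: "perimeter m \<nu> D = emeasure step_law (D \<times> - D)"
  proof -
    have "perimeter m \<nu> D = (\<integral>\<^sup>+x. \<integral>\<^sup>+y. indicator (D \<times> - D) (x, y) \<partial>m x \<partial>\<nu>)"
      unfolding perimeter_def interaction_def nn_integral_completion
      by (intro nn_integral_cong) (auto simp: indicator_times sets_m nn_integral_cmult mult.commute)
    also have "\<dots> = emeasure step_law (D \<times> - D)"
      by (subst nn_integral_step_law[symmetric]) auto
    finally show ?thesis .
  qed
  have "cheeger_constant m \<nu> \<le> perimeter m \<nu> D / emeasure \<nu> D"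
    unfolding cheeger_constant_def using False half D'
    by (intro INF_lower2[of D]) (auto simp: zero_less_iff_neq_zero)
  then have "cheeger_constant m \<nu> * emeasure \<nu> D \<le> perimeter m \<nu> D / emeasure \<nu> D * emeasure \<nu> D"
    by (rule mult_right_mono) simp
  also have "\<dots> = perimeter m \<nu> D"
    using False by (simp add: ennreal_divide_times less_top[symmetric])
  finally show ?thesis by (simp add: per)
qed simp

lemma nn_integral_levels: "(\<integral>\<^sup>+t. indicator {s..<r} t \<partial>lborel) = ennreal (r - s)"
  by (cases "s \<le> r") (auto simp: ennreal_neg)

text \<open>
  For each level \<open>t \<ge> 0\<close> the set \<open>{g > t}\<close> satisfies the isoperimetric inequality; Fubini's theorem
  on both sides of the inequality integrated over \<open>t\<close> gives the claim, since \<open>(g x - g y)\<^sup>+\<close> is the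
  length of the set of levels \<open>t\<close> at which the step from \<open>x\<close> to \<open>y\<close> leaves \<open>{g > t}\<close>.
\<close>

lemma cheeger_coarea:
  assumes g [measurable]: "g \<in> borel_measurable borel" and nonneg: "\<And>x. 0 \<le> g x"
    and half: "emeasure \<nu> {x. 0 < g x} \<le> 1 / 2"
  shows "cheeger_constant m \<nu> * (\<integral>\<^sup>+x. ennreal (g x) \<partial>\<nu>)
           \<le> (\<integral>\<^sup>+(x, y). ennreal (g x - g y) \<partial>step_law)"
proof -
  interpret step: sigma_finite_measure step_law by (rule sigma_finite_step_law)
  interpret levels: pair_sigma_finite \<nu> lborel ..
  interpret step_levels: pair_sigma_finite step_law lborel ..
  let ?D = "\<lambda>t. {x. t < g x}"
  have "(\<integral>\<^sup>+x. ennreal (g x) \<partial>\<nu>) = (\<integral>\<^sup>+x. \<integral>\<^sup>+t. indicator {0..<g x} t \<partial>lborel \<partial>\<nu>)"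
    unfolding nn_integral_levels by simp
  also have "\<dots> = (\<integral>\<^sup>+t. \<integral>\<^sup>+x. indicator {0..<g x} t \<partial>\<nu> \<partial>lborel)"
    by (rule levels.Fubini'[symmetric]) (simp add: indicator_def of_bool_def)
  also have "\<dots> = (\<integral>\<^sup>+t. indicator {0..} t * emeasure \<nu> (?D t) \<partial>lborel)"
  proof (rule nn_integral_cong)
    fix t :: real
    have "(\<integral>\<^sup>+x. indicator {0..<g x} t \<partial>\<nu>) = (\<integral>\<^sup>+x. indicator {0..} t * indicator (?D t) x \<partial>\<nu>)"
      by (intro nn_integral_cong) (auto simp: indicator_def)
    then show "(\<integral>\<^sup>+x. indicator {0..<g x} t \<partial>\<nu>) = indicator {0..} t * emeasure \<nu> (?D t)"
      by (simp add: nn_integral_cmult)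
  qed
  finally have "cheeger_constant m \<nu> * (\<integral>\<^sup>+x. ennreal (g x) \<partial>\<nu>)
      = (\<integral>\<^sup>+t. indicator {0..} t * (cheeger_constant m \<nu> * emeasure \<nu> (?D t)) \<partial>lborel)"
    by (simp add: nn_integral_cmult[symmetric] mult.left_commute)
  also have "\<dots> \<le> (\<integral>\<^sup>+t. indicator {0..} t * emeasure step_law (?D t \<times> - ?D t) \<partial>lborel)"
  proof (rule nn_integral_mono)
    fix t :: real
    have "cheeger_constant m \<nu> * emeasure \<nu> (?D t) \<le> emeasure step_law (?D t \<times> - ?D t)" if "0 \<le> t"
    proof (rule cheeger_mult_le)
      have "emeasure \<nu> (?D t) \<le> emeasure \<nu> {x. 0 < g x}"
        using that by (intro emeasure_mono) (auto simp: sets_stationary)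
      with half show "emeasure \<nu> (?D t) \<le> 1 / 2" by simp
    qed simp
    then show "indicator {0..} t * (cheeger_constant m \<nu> * emeasure \<nu> (?D t))
        \<le> indicator {0..} t * emeasure step_law (?D t \<times> - ?D t)"
      by (simp add: indicator_def)
  qed
  also have "\<dots> = (\<integral>\<^sup>+t. \<integral>\<^sup>+p. indicator {g (snd p)..<g (fst p)} t \<partial>step_law \<partial>lborel)"
  proof (rule nn_integral_cong)
    fix t :: real
    have "(\<integral>\<^sup>+p. indicator {g (snd p)..<g (fst p)} t \<partial>step_law)
        = (\<integral>\<^sup>+p. indicator {0..} t * indicator (?D t \<times> - ?D t) p \<partial>step_law)"
      using nonneg by (intro nn_integral_cong) (auto simp: indicator_def intro: order_trans)
    then show "indicator {0..} t * emeasure step_law (?D t \<times> - ?D t)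
        = (\<integral>\<^sup>+p. indicator {g (snd p)..<g (fst p)} t \<partial>step_law)"
      by (simp add: nn_integral_cmult)
  qed
  also have "\<dots> = (\<integral>\<^sup>+p. \<integral>\<^sup>+t. indicator {g (snd p)..<g (fst p)} t \<partial>lborel \<partial>step_law)"
    by (rule step_levels.Fubini') (simp add: indicator_def of_bool_def)
  also have "\<dots> = (\<integral>\<^sup>+(x, y). ennreal (g x - g y) \<partial>step_law)"
    unfolding nn_integral_levels by (simp add: case_prod_beta')
  finally show ?thesis .
qed

text \<open>
  For \<open>t < 0\<close> the set \<open>{u > t}\<close> may carry more than half of the mass, so the levels of both signs
  are treated separately: the coarea inequality is applied to \<open>u\<^sup>+\<close> and \<open>u\<^sup>-\<close>.  It counts a step only
  in the direction in which it leaves the level set; reversibility turns this into half of the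
  count of both directions.
\<close>

lemma cheeger_le_total_variation:
  assumes u [measurable]: "u \<in> borel_measurable borel"
    and pos: "emeasure \<nu> {x. 0 < u x} \<le> 1 / 2" and neg: "emeasure \<nu> {x. u x < 0} \<le> 1 / 2"
  shows "cheeger_constant m \<nu> * (\<integral>\<^sup>+x. ennreal \<bar>u x\<bar> \<partial>\<nu>) \<le> total_variation m \<nu> u"
proof -
  let ?h = "cheeger_constant m \<nu>"
  define p where "p = (\<lambda>x. max 0 (u x))"
  define n where "n = (\<lambda>x. max 0 (- u x))"
  define \<phi> where "\<phi> = (\<lambda>(x, y). ennreal (p x - p y) + ennreal (n x - n y))"
  have [measurable]: "p \<in> borel_measurable borel" "n \<in> borel_measurable borel"
    unfolding p_def n_def by measurable
  have \<phi> [measurable]: "\<phi> \<in> borel_measurable (borel \<Otimes>\<^sub>M borel)"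
    unfolding \<phi>_def by measurable
  have sym: "\<phi> q + \<phi> (prod.swap q) = ennreal \<bar>u (snd q) - u (fst q)\<bar>" for q
  proof -
    \<comment> \<open>The maxima are the truncation at \<open>0\<close> performed by \<open>ennreal\<close>.\<close>
    have plus: "\<phi> q = ennreal (max 0 (p (fst q) - p (snd q)) + max 0 (n (fst q) - n (snd q)))" for q
      by (simp add: \<phi>_def case_prod_beta' ennreal_max_0)
    have "\<phi> q + \<phi> (prod.swap q)
        = ennreal ((max 0 (p (fst q) - p (snd q)) + max 0 (n (fst q) - n (snd q)))
            + (max 0 (p (snd q) - p (fst q)) + max 0 (n (snd q) - n (fst q))))"
      unfolding plus by (subst ennreal_plus[symmetric]) simp_all
    also have "(max 0 (p (fst q) - p (snd q)) + max 0 (n (fst q) - n (snd q)))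
            + (max 0 (p (snd q) - p (fst q)) + max 0 (n (snd q) - n (fst q)))
        = \<bar>p (fst q) - p (snd q)\<bar> + \<bar>n (fst q) - n (snd q)\<bar>"
      by linarith
    also have "\<dots> = \<bar>u (snd q) - u (fst q)\<bar>"
      unfolding p_def n_def
      by (cases "u (fst q) \<le> 0"; cases "u (snd q) \<le> 0") (simp_all add: max_def)
    finally show ?thesis .
  qed
  have "ennreal \<bar>u x\<bar> = ennreal (p x) + ennreal (n x)" for x
    by (simp add: p_def n_def ennreal_plus[symmetric] max_def del: ennreal_plus)
  then have "?h * (\<integral>\<^sup>+x. ennreal \<bar>u x\<bar> \<partial>\<nu>) = ?h * ((\<integral>\<^sup>+x. ennreal (p x) \<partial>\<nu>) + (\<integral>\<^sup>+x. ennreal (n x) \<partial>\<nu>))"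
    by (simp add: nn_integral_add)
  also have "\<dots> \<le> (\<integral>\<^sup>+(x, y). ennreal (p x - p y) \<partial>step_law) + (\<integral>\<^sup>+(x, y). ennreal (n x - n y) \<partial>step_law)"
    unfolding distrib_left
    by (intro add_mono cheeger_coarea)
      (use pos neg in \<open>auto simp: p_def n_def less_max_iff_disj\<close>)
  also have "\<dots> = (\<integral>\<^sup>+q. \<phi> q \<partial>step_law)"
    unfolding \<phi>_def
    by (subst nn_integral_add[symmetric]) (auto simp: case_prod_beta')
  \<comment> \<open>By reversibility \<open>\<phi>\<close> and its reflection have the same integral.\<close>
  also have "\<dots> = 1 / 2 * ((\<integral>\<^sup>+q. \<phi> q \<partial>step_law) + (\<integral>\<^sup>+q. \<phi> (prod.swap q) \<partial>step_law))"
  proof -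
    have "1 / 2 * (c + c) = c" for c :: ennreal
      using mult_divide_eq_ennreal[of 2 c]
      by (simp add: mult_2[symmetric] ennreal_times_divide mult.commute)
    then show ?thesis by (simp only: nn_integral_step_law_swap[OF \<phi>])
  qed
  also have "\<dots> = 1 / 2 * (\<integral>\<^sup>+q. \<phi> q + \<phi> (prod.swap q) \<partial>step_law)"
    by (subst nn_integral_add) auto
  also have "\<dots> = total_variation m \<nu> u"
    unfolding sym by (simp add: total_variation_eq_step_law[OF u] case_prod_beta')
  finally show ?thesis .
qed

section \<open>Eigenfunctions\<close>

text \<open>
  \<open>\<xi>\<close> dominates the function that is \<open>1\<close> on \<open>{u > 0}\<close> and \<open>-1\<close> elsewhere, whose integral is
  \<open>2 \<nu> {u > 0} - 1\<close>.
\<close>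

lemma median_of_mean_zero_sign:
  assumes u [measurable]: "u \<in> borel_measurable borel"
    and \<xi>: "integrable (completion \<nu>) \<xi>" "(LINT x|completion \<nu>. \<xi> x) = 0"
    and sgn: "AE x in \<nu>. \<xi> x \<in> multi_sign (u x)"
  shows "emeasure \<nu> {x. 0 < u x} \<le> 1 / 2"
proof -
  interpret c: prob_space "completion \<nu>" by (rule prob_space_completion)
  have [measurable]: "{x. 0 < u x} \<in> sets (completion \<nu>)" "{x. 0 < u x} \<in> sets \<nu>"
    by (auto intro!: sets_completionI_sets simp: sets_stationary)
  have ind: "integrable (completion \<nu>) (\<lambda>x. 2 * indicator {x. 0 < u x} x :: real)"
    by (intro integrable_mult_right integrable_real_indicator)
      (simp_all add: less_top[symmetric] c.emeasure_finite del: emeasure_completion)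
  then have int: "integrable (completion \<nu>) (\<lambda>x. 2 * indicator {x. 0 < u x} x - 1 :: real)"
    by (intro Bochner_Integration.integrable_diff c.integrable_const)
  have "(LINT x|completion \<nu>. 2 * indicator {x. 0 < u x} x - 1) \<le> (LINT x|completion \<nu>. \<xi> x)"
  proof (rule integral_mono_AE[OF int])
    show "AE x in completion \<nu>. 2 * indicator {x. 0 < u x} x - 1 \<le> \<xi> x"
      using sgn unfolding AE_completion_iff
      by eventually_elim (auto simp: multi_sign_def split: if_splits)
  qed (rule \<xi>(1))
  then have "2 * measure (completion \<nu>) {x. 0 < u x} - 1 \<le> 0"
    using \<xi>(2) c.prob_space ind
    by (subst (asm) Bochner_Integration.integral_diff) simp_all
  then have "measure \<nu> {x. 0 < u x} \<le> 1 / 2"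
    by (simp add: measure_completion)
  then have "ennreal (measure \<nu> {x. 0 < u x}) \<le> ennreal (1 / 2)"
    by (rule ennreal_leI)
  then show ?thesis
    by (simp add: emeasure_eq_measure divide_ennreal_def)
qed

end

theorem theorem6p15:
  fixes m :: "'a::polish_space \<Rightarrow> 'a measure"
    and \<nu> :: "'a measure"
    and lam :: real
  assumes "metric_random_walk m"
    and "radon_measure \<nu>"
    and "prob_space \<nu>"
    and "invariant_measure m \<nu>"
    and "reversible_measure m \<nu>"
    and "m_connected m \<nu>"
    and "lam \<noteq> 0"
    and "m_eigenvalue m \<nu> lam"
  shows "enn2ereal (cheeger_constant m \<nu>) \<le> ereal lam"
proof -
  interpret reversible_random_walk m \<nu>
    using assms unfolding reversible_random_walk_def reversible_random_walk_axioms_def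
    by (auto simp: radon_measure_def)
  let ?c = "completion \<nu>"
  interpret c: prob_space ?c by (rule prob_space_completion)
  obtain u \<xi> where u: "u \<in> L2_functions \<nu>" and norm: "(LINT x|?c. \<bar>u x\<bar>) = 1"
    and sgn: "AE x in ?c. \<xi> x \<in> multi_sign (u x)"
    and sub: "(\<lambda>x. lam * \<xi> x) \<in> TV_subdifferential m \<nu> u"
    using assms(8) by (auto simp: m_eigenvalue_def m_eigenpair_def one_laplacian_def)
  have um [measurable]: "u \<in> borel_measurable ?c"
    using u by (simp add: L2_functions_def)
  have int_u: "integrable ?c u"
    using u c.square_integrable_imp_integrable[of u] unfolding L2_functions_def by blast
  have "(\<lambda>x. lam * \<xi> x) \<in> L2_functions \<nu>"
    using sub by (simp add: TV_subdifferential_def)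
  then have int_w: "integrable ?c (\<lambda>x. lam * \<xi> x)"
    using c.square_integrable_imp_integrable[of "\<lambda>x. lam * \<xi> x"] unfolding L2_functions_def by blast
  then have int_\<xi>: "integrable ?c \<xi>"
    by (rule integrable_mult_left_iff[THEN iffD1, THEN disjE]) (use \<open>lam \<noteq> 0\<close> in blast)+
  then have [measurable]: "\<xi> \<in> borel_measurable ?c"
    by simp
  \<comment> \<open>The subgradient inequality is used for real numbers, where it can be rearranged.\<close>
  obtain a where a: "total_variation m \<nu> u = ennreal a" "0 \<le> a"
    using sub by (cases "total_variation m \<nu> u") (auto simp: TV_subdifferential_def)
  have test: "ereal (a + (LINT x|?c. lam * \<xi> x * (z x - u x))) \<le> enn2ereal (total_variation m \<nu> z)"
    if "z \<in> L2_functions \<nu>" for z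
    using sub that a by (auto simp: TV_subdifferential_def enn2ereal_ennreal)

  have "a \<le> lam"
  proof -
    have "(LINT x|?c. lam * \<xi> x * (0 - u x)) = (LINT x|?c. - lam * \<bar>u x\<bar>)"
    proof (rule integral_cong_AE)
      show "AE x in ?c. lam * \<xi> x * (0 - u x) = - lam * \<bar>u x\<bar>"
        using sgn by eventually_elim (auto simp: multi_sign_def split: if_splits)
    qed measurable
    then show ?thesis
      using test[of "\<lambda>_. 0"] norm by (simp add: L2_functions_def total_variation_def zero_ennreal.rep_eq)
  qed

  \<comment> \<open>Adding a constant does not change the total variation.\<close>
  have shift: "c * (LINT x|?c. \<xi> x) * lam \<le> 0" for c
  proof -
    have "(\<lambda>x. u x + c) \<in> L2_functions \<nu>"
      using u int_u by (simp add: L2_functions_def power2_sum)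
    from test[OF this] show ?thesis
      using a by (simp add: total_variation_def enn2ereal_ennreal mult_ac)
  qed
  have mean: "(LINT x|?c. \<xi> x) = 0"
  proof -
    \<comment> \<open>The shift equal to the coefficient itself makes the inequality say that a square is at most \<open>0\<close>.\<close>
    have "((LINT x|?c. \<xi> x) * lam)\<^sup>2 \<le> 0"
      using shift[of "(LINT x|?c. \<xi> x) * lam"] by (simp add: power2_eq_square mult.assoc)
    with \<open>lam \<noteq> 0\<close> show ?thesis by simp
  qed

  \<comment> \<open>Level sets have to be Borel for the measure of pairs, so \<open>u\<close> is replaced by a Borel version.\<close>
  obtain v where v [measurable]: "v \<in> borel_measurable borel" and uv: "AE x in \<nu>. u x = v x"
    using completion_ex_borel_measurable_real[OF um]
    by (auto cong: measurable_cong_sets simp: sets_stationary)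
  have sgn': "AE x in \<nu>. \<xi> x \<in> multi_sign (v x)"
    using sgn[unfolded AE_completion_iff] uv by eventually_elim simp
  have "emeasure \<nu> {x. 0 < v x} \<le> 1 / 2"
    using median_of_mean_zero_sign[OF v int_\<xi> mean sgn'] .
  moreover have "emeasure \<nu> {x. 0 < - v x} \<le> 1 / 2"
  proof (rule median_of_mean_zero_sign)
    show "AE x in \<nu>. - \<xi> x \<in> multi_sign (- v x)"
      using sgn' by eventually_elim (auto simp: multi_sign_def split: if_splits)
  qed (use int_\<xi> mean in auto)
  ultimately have "cheeger_constant m \<nu> * (\<integral>\<^sup>+x. ennreal \<bar>v x\<bar> \<partial>\<nu>) \<le> total_variation m \<nu> v"
    by (intro cheeger_le_total_variation) auto
  also have "total_variation m \<nu> v = total_variation m \<nu> u"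
    using total_variation_eq_step_law[OF v uv] total_variation_eq_step_law[OF v, of v] by simp
  also have "(\<integral>\<^sup>+x. ennreal \<bar>v x\<bar> \<partial>\<nu>) = (\<integral>\<^sup>+x. ennreal \<bar>u x\<bar> \<partial>?c)"
    unfolding nn_integral_completion
    by (rule nn_integral_cong_AE) (use uv in eventually_elim, simp)
  also have "\<dots> = 1"
    using int_u norm by (subst nn_integral_eq_integral) auto
  finally have "cheeger_constant m \<nu> \<le> ennreal lam"
    using ennreal_leI[OF \<open>a \<le> lam\<close>] by (simp add: a)
  then show ?thesis
    using a(2) \<open>a \<le> lam\<close> by (simp add: less_eq_ennreal.rep_eq enn2ereal_ennreal)
qed

end
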